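(* Let $L$ be a lattice. (i) An element $a\in L\setminus\{1\}$ has a CPR-factorization if and only if $\mathrm{Min}(a)$ is finite and its elements are pairwise comaximal; if it exists, the CPR-factorization of $a$ is unique (up to the order of the factors). (ii) $L$ is a CPR-lattice if and only if $L$ is treed and $\mathrm{Min}(a)$ is finite for all $a\in L\setminus\{1\}$.
   Context: A multiplicative lattice is an ordered commutative monoid $(L,\le,\cdot)$ such that $(L,\le)$ is a complete lattice with top element $1$ and bottom element $0$, $0\ne 1$; $x(\bigvee Y)=\bigvee_{y\in Y}xy$ for all $x\in L$, $Y\subseteq L$; and $x1=x$ for all $x\in L$. An element $c\in L$ is compact if $c\le\bigvee H$ with $H\subseteq L$ implies $c\le\bigvee F$ for some finite $F\subseteq H$. A subset $G\subseteq L$ generates $L$ if every element of $L$ is the join of some subset of $G$. Throughout, "lattice" means a multiplicative lattice $L$ such that (i) $1$ is compact, (ii) $L$ is generated by the set of its compact elements, (iii) every product of two compact elements is compact. An element $p\ne 1$ is prime if $xy\le p$ implies $x\le p$ or $y\le p$. $\mathrm{Min}(a)$ is the set of minimal primes over $a$, i.e. minimal elements of the set of prime elements $p\ge a$. The radical of $a\in L$ is $\sqrt{a}=\bigvee\{x\in L : x^n\le a \text{ for some } n\ge 1\}$. Elements $a,b\in L$ are comaximal if $a\vee b=1$. For $a\in L\setminus\{1\}$, a CPR-factorization (comaximal prime radical factorization) of $a$ is a factorization $a=a_1\cdots a_n$ ($n\ge1$) with $a_1,\dots,a_n\in L\setminus\{1\}$ pairwise comaximal such that each $\sqrt{a_i}$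 is a prime element. $L$ is a CPR-lattice if every $x\in L\setminus\{1\}$ has a CPR-factorization. $L$ is treed if its set of prime elements is a tree under $\le$, equivalently, any two incomparable prime elements of $L$ are comaximal. *)

theory Defs
  imports Main "HOL-Library.Multiset"
begin

definition (in complete_lattice) compact_element :: "'a \<Rightarrow> bool" where
  "compact_element c \<longleftrightarrow>
     (\<forall>H. c \<le> Sup H \<longrightarrow> (\<exists>F. finite F \<and> F \<subseteq> H \<and> c \<le> Sup F))"

definition (in complete_lattice) generates :: "'a set \<Rightarrow> bool" where
  "generates G \<longleftrightarrow> (\<forall>x. \<exists>S. S \<subseteq> G \<and> x = Sup S)"

text \<open>The bottom element, written 0 in the literature, is \<open>bot\<close>; the top element is the
  monoid unit \<open>1\<close>.\<close>

class multiplicative_lattice = complete_lattice + comm_monoid_mult +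
  assumes mult_left_monotone: "x \<le> y \<Longrightarrow> z * x \<le> z * y"
    and one_eq_top: "1 = top"
    and bot_neq_one: "bot \<noteq> 1"
    and mult_Sup_distrib: "x * Sup Y = Sup ((\<lambda>y. x * y) ` Y)"

class compact_mult_lattice = multiplicative_lattice +
  assumes compact_one: "compact_element 1"
    and generates_compact: "generates {c. compact_element c}"
    and compact_mult: "compact_element c \<Longrightarrow> compact_element d \<Longrightarrow> compact_element (c * d)"

definition prime_element :: "'a::multiplicative_lattice \<Rightarrow> bool" where
  "prime_element p \<longleftrightarrow> p \<noteq> 1 \<and> (\<forall>x y. x * y \<le> p \<longrightarrow> x \<le> p \<or> y \<le> p)"

definition minimal_primes :: "'a::multiplicative_lattice \<Rightarrow> 'a set" where
  "minimal_primes a =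
     {p. prime_element p \<and> a \<le> p \<and> (\<forall>q. prime_element q \<and> a \<le> q \<and> q \<le> p \<longrightarrow> q = p)}"

definition radical :: "'a::multiplicative_lattice \<Rightarrow> 'a" where
  "radical a = Sup {x. \<exists>n\<ge>1. x ^ n \<le> a}"

definition comaximal :: "'a::multiplicative_lattice \<Rightarrow> 'a \<Rightarrow> bool" where
  "comaximal a b \<longleftrightarrow> sup a b = 1"

text \<open>The factors form a list, and comaximality is required of factors at distinct positions, so
  a repeated factor has to be comaximal to itself.\<close>

definition CPR_factorization :: "'a::multiplicative_lattice \<Rightarrow> 'a list \<Rightarrow> bool" where
  "CPR_factorization a xs \<longleftrightarrow>
     xs \<noteq> [] \<and> a = prod_list xs \<and>
     (\<forall>x\<in>set xs. x \<noteq> 1 \<and> prime_element (radical x)) \<and>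
     (\<forall>i<length xs. \<forall>j<length xs. i \<noteq> j \<longrightarrow> comaximal (xs ! i) (xs ! j))"

definition CPR_lattice :: "'a::multiplicative_lattice itself \<Rightarrow> bool" where
  "CPR_lattice _ \<longleftrightarrow> (\<forall>a::'a. a \<noteq> 1 \<longrightarrow> (\<exists>xs. CPR_factorization a xs))"

text \<open>The poset of primes is a tree in the sense that the primes below any given prime form a
  chain. The lemma \<open>treed_iff_comaximal\<close> below gives the usual equivalent description.\<close>

definition treed :: "'a::multiplicative_lattice itself \<Rightarrow> bool" where
  "treed _ \<longleftrightarrow>
     (\<forall>r p q::'a. prime_element r \<and> prime_element p \<and> prime_element q \<and> p \<le> r \<and> q \<le> r
        \<longrightarrow> p \<le> q \<or> q \<le> p)"

lemma mult_sup_distrib: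
  fixes x y z :: "'a::multiplicative_lattice"
  shows "x * sup y z = sup (x * y) (x * z)"
  using mult_Sup_distrib[of x "{y, z}"] by simp

lemma mult_le_left:
  fixes x y :: "'a::multiplicative_lattice"
  shows "x * y \<le> x"
  using mult_left_monotone[of y 1 x] by (simp add: one_eq_top[symmetric]) (simp add: one_eq_top)

lemma exists_prime_above:
  fixes a :: "'a::compact_mult_lattice"
  assumes "a \<noteq> 1"
  obtains m where "prime_element m" "a \<le> m"
proof -
  let ?A = "{x. a \<le> x \<and> x \<noteq> 1}"
  have ub: "\<exists>u\<in>?A. \<forall>c\<in>C. c \<le> u"
    if C: "C \<subseteq> ?A" "\<forall>x\<in>C. \<forall>y\<in>C. x \<le> y \<or> y \<le> x" for C
  proof (cases "C = {}")
    case True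
    then show ?thesis using assms by auto
  next
    case False
    have fin: "\<exists>c\<in>C. Sup F \<le> c" if "finite F" "F \<subseteq> C" for F
      using that
    proof (induction F rule: finite_induct)
      case empty
      then show ?case using False by auto
    next
      case (insert x F)
      then obtain c where "c \<in> C" "Sup F \<le> c" by auto
      moreover have "x \<in> C" using insert by auto
      ultimately show ?case using C(2) by (metis Sup_insert le_sup_iff order.trans order_refl)
    qed
    have "Sup C \<noteq> 1"
    proof
      assume "Sup C = 1"
      then obtain F where F: "finite F" "F \<subseteq> C" "1 \<le> Sup F"
        using compact_one unfolding compact_element_def by (metis order_refl)
      then obtain c where "c \<in> C" "1 \<le> c" using fin by (meson order.trans)
      then show False using C(1) by (auto simp: one_eq_top top_unique)
    qed
    moreover have "a \<le> Sup C"
      using False C(1) by (metis (no_types, lifting) Sup_upper2 ex_in_conv mem_Collect_eq subsetD)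
    ultimately show ?thesis by (auto intro: Sup_upper)
  qed
  obtain m where m: "m \<in> ?A" "\<And>x. x \<in> ?A \<Longrightarrow> m \<le> x \<Longrightarrow> x = m"
  proof -
    have "\<exists>m\<in>?A. \<forall>x\<in>?A. m \<le> x \<longrightarrow> x = m"
    proof (rule predicate_Zorn)
      show "partial_order_on ?A (relation_of (\<le>) ?A)"
        by (rule partial_order_on_relation_ofI) auto
    next
      fix C
      assume "C \<in> Chains (relation_of (\<le>) ?A)"
      then have "C \<subseteq> ?A" "\<forall>x\<in>C. \<forall>y\<in>C. x \<le> y \<or> y \<le> x"
        by (auto simp: Chains_def relation_of_def)
      then show "\<exists>u\<in>?A. \<forall>c\<in>C. c \<le> u" by (rule ub)
    qed
    then show thesis using that by blast
  qed
  have "x \<le> m \<or> y \<le> m" if xy: "x * y \<le> m" for x y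
  proof (rule ccontr)
    assume "\<not> (x \<le> m \<or> y \<le> m)"
    then have "sup m x \<noteq> m" "sup m y \<noteq> m" by (auto simp: sup.absorb_iff1)
    then have 1: "sup m x = 1" and 2: "sup m y = 1"
      using m by (auto intro: le_supI1)
    have "x * sup m y \<le> m"
      using xy mult_le_left[of m x] by (simp add: mult_sup_distrib mult.commute)
    then have "x \<le> m" using 2 by simp
    with \<open>\<not> (x \<le> m \<or> y \<le> m)\<close> show False by blast
  qed
  then have "prime_element m" using m by (auto simp: prime_element_def)
  then show thesis using m that by auto
qed

lemma treed_iff_comaximal:
  "treed TYPE('a::compact_mult_lattice) \<longleftrightarrow>
     (\<forall>p q::'a. prime_element p \<and> prime_element q \<and> \<not> p \<le> q \<and> \<not> q \<le> p \<longrightarrow> comaximal p q)"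
proof
  assume t: "treed TYPE('a)"
  show "\<forall>p q::'a. prime_element p \<and> prime_element q \<and> \<not> p \<le> q \<and> \<not> q \<le> p \<longrightarrow> comaximal p q"
  proof (intro allI impI, rule ccontr)
    fix p q :: 'a
    assume pq: "prime_element p \<and> prime_element q \<and> \<not> p \<le> q \<and> \<not> q \<le> p"
      and "\<not> comaximal p q"
    then obtain r where "prime_element r" "sup p q \<le> r"
      using exists_prime_above[of "sup p q"] by (auto simp: comaximal_def)
    then show False using t pq unfolding treed_def by (meson le_sup_iff)
  qed
next
  assume c: "\<forall>p q::'a. prime_element p \<and> prime_element q \<and> \<not> p \<le> q \<and> \<not> q \<le> p \<longrightarrow> comaximal p q"
  show "treed TYPE('a)"
    unfolding treed_def
  proof (intro allI impI, rule ccontr)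
    fix r p q :: 'a
    assume a: "prime_element r \<and> prime_element p \<and> prime_element q \<and> p \<le> r \<and> q \<le> r"
      and "\<not> (p \<le> q \<or> q \<le> p)"
    then have "sup p q = 1" using c by (auto simp: comaximal_def)
    then have "1 \<le> r" using a by (metis le_sup_iff)
    then show False using a by (auto simp: prime_element_def one_eq_top top_unique)
  qed
qed

end

theory Submission
  imports Defs
begin

text \<open>
  The proof is geometric: an element \<open>a\<close> is studied through the set of primes above it, and
  comaximality of two elements says that no prime lies above both. Two applications of Zorn's
  lemma link primes with elements. Every prime over \<open>a\<close> contains a minimal one, and a compact
  element below all primes over \<open>a\<close> has a power below \<open>a\<close>; hence the radical is the largest element
  below all these primes.

  If \<open>a\<close> is a product of pairwise comaximal factors with prime radicals, a prime over \<open>a\<close> lies over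
  one factor and therefore over its radical, so that \<open>Min(a)\<close> consists of these radicals. Given a
  second such factorization, let \<open>x\<close> and \<open>y\<close> be factors with the same radical. A common prime of \<open>x\<close>
  and of another factor in the factorization of \<open>y\<close> would lie above two comaximal elements, so \<open>x\<close> is
  comaximal to the cofactor \<open>s\<close> of \<open>y\<close>. Since \<open>y s = a \<le> x\<close>, this gives
  \<open>y = y (x \<squnion> s) \<le> x\<close>, and \<open>x = y\<close> by symmetry.

  Conversely, suppose that \<open>Min(a)\<close> is finite with pairwise comaximal elements. A minimal prime \<open>p\<close>
  is then comaximal to the product \<open>v\<close> of the others, and \<open>p v\<close> lies below all primes over \<open>a\<close>. As \<open>1\<close>
  is compact, there are compact \<open>c \<le> p\<close> and \<open>d \<le> v\<close> with \<open>c \<squnion> d = 1\<close>, and some power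
  \<open>(c d)\<^sup>k\<close> lies below \<open>a\<close>. So \<open>a = (a \<squnion> c\<^sup>k) (a \<squnion> d\<^sup>k)\<close> with comaximal factors;
  the radical of the first one is \<open>p\<close>, and the second one has the remaining minimal primes.
  Induction on \<open>Min(a)\<close> (lemma \<open>exists_CPR_factors\<close>) yields the factorization.

  The statement on CPR-lattices follows since distinct minimal primes are incomparable, while two
  incomparable primes \<open>p\<close> and \<open>q\<close> are exactly the minimal primes of \<open>p q\<close>.
\<close>

section \<open>Primes and comaximality\<close>

lemma mult_mono_lattice:
  fixes w x y z :: "'a::multiplicative_lattice"
  assumes "w \<le> x" "y \<le> z"
  shows "w * y \<le> x * z"
  using mult_left_monotone[OF assms(2), of w] mult_left_monotone[OF assms(1), of z]
  by (simp add: mult.commute)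

lemma mult_le_right:
  fixes x y :: "'a::multiplicative_lattice"
  shows "x * y \<le> y"
  using mult_le_left[of y x] by (simp add: mult.commute)

lemma one_le_iff:
  fixes x :: "'a::multiplicative_lattice"
  shows "1 \<le> x \<longleftrightarrow> x = 1"
  by (simp add: one_eq_top top_unique)

lemma le_one:
  fixes x :: "'a::multiplicative_lattice"
  shows "x \<le> 1"
  by (simp add: one_eq_top)

lemma prime_element_multD:
  "prime_element p \<Longrightarrow> x * y \<le> p \<Longrightarrow> x \<le> p \<or> y \<le> p"
  by (auto simp: prime_element_def)

lemma not_one_le_prime: "prime_element p \<Longrightarrow> \<not> 1 \<le> p"
  by (simp add: prime_element_def one_le_iff)

lemma prime_element_powerD:
  assumes "prime_element p" "x ^ n \<le> p"
  shows "x \<le> p"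
  using assms(2)
  by (induction n) (use assms(1) in \<open>auto simp: not_one_le_prime dest: prime_element_multD\<close>)

lemma prime_element_prodD:
  assumes "finite S" "prime_element p" "\<Prod>S \<le> p"
  shows "\<exists>x\<in>S. x \<le> p"
  using assms(1,3)
  by (induction S rule: finite_induct)
    (use assms(2) in \<open>auto simp: not_one_le_prime dest: prime_element_multD\<close>)

lemma prod_le_member:
  fixes x :: "'a::multiplicative_lattice"
  assumes "finite S" "x \<in> S"
  shows "\<Prod>S \<le> x"
  using assms by (simp add: prod.remove mult_le_left)

lemma comaximal_commute: "comaximal x y \<longleftrightarrow> comaximal y x"
  by (simp add: comaximal_def sup.commute)

lemma comaximal_mono: "comaximal x y \<Longrightarrow> x \<le> x' \<Longrightarrow> y \<le> y' \<Longrightarrow> comaximal x' y'"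
  unfolding comaximal_def by (metis one_le_iff sup.mono)

lemma comaximal_self_iff: "comaximal x x \<longleftrightarrow> x = 1"
  by (simp add: comaximal_def)

lemma comaximal_no_common_prime:
  assumes "comaximal x y" "prime_element p" "x \<le> p" "y \<le> p"
  shows False
  using assms not_one_le_prime[of p] by (metis comaximal_def le_sup_iff)

text \<open>
  A join other than \<open>1\<close> lies below some prime. In this form it is evident that comaximality passes
  to products and powers, since a prime over a product lies over one of its factors.
\<close>

lemma comaximal_iff_no_common_prime:
  fixes x y :: "'a::compact_mult_lattice"
  shows "comaximal x y \<longleftrightarrow> \<not> (\<exists>p. prime_element p \<and> x \<le> p \<and> y \<le> p)"
  using comaximal_no_common_prime[of x y] exists_prime_above[of "sup x y"]
  by (metis comaximal_def le_sup_iff)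

lemma comaximal_prod:
  fixes x :: "'a::compact_mult_lattice"
  assumes "finite S" "\<And>y. y \<in> S \<Longrightarrow> comaximal x y"
  shows "comaximal x (\<Prod>S)"
  using assms prime_element_prodD unfolding comaximal_iff_no_common_prime by blast

lemma comaximal_powers:
  fixes x y :: "'a::compact_mult_lattice"
  assumes "comaximal x y"
  shows "comaximal (x ^ m) (y ^ n)"
  using assms prime_element_powerD unfolding comaximal_iff_no_common_prime by blast

section \<open>Minimal primes and the radical\<close>

lemma minimal_primesD:
  assumes "p \<in> minimal_primes a"
  shows "prime_element p" "a \<le> p" "\<And>q. prime_element q \<Longrightarrow> a \<le> q \<Longrightarrow> q \<le> p \<Longrightarrow> q = p"
  using assms by (auto simp: minimal_primes_def)

text \<open>
  Zorn's lemma applies downwards because the meet of a chain of primes is prime: if neither factor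
  of a product lies below the meet, some member of the chain lies above neither factor.
\<close>

lemma minimal_prime_below:
  fixes a p :: "'a::multiplicative_lattice"
  assumes p: "prime_element p" "a \<le> p"
  obtains q where "q \<in> minimal_primes a" "q \<le> p"
proof -
  let ?A = "{q. prime_element q \<and> a \<le> q \<and> q \<le> p}"
  have "\<exists>m\<in>?A. \<forall>x\<in>?A. x \<le> m \<longrightarrow> x = m"
  proof (rule predicate_Zorn)
    show "partial_order_on ?A (relation_of (\<lambda>x y. y \<le> x) ?A)"
      by (rule partial_order_on_relation_ofI) auto
  next
    fix C
    assume "C \<in> Chains (relation_of (\<lambda>x y. y \<le> x) ?A)"
    then have C: "C \<subseteq> ?A" "\<And>x y. x \<in> C \<Longrightarrow> y \<in> C \<Longrightarrow> x \<le> y \<or> y \<le> x"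
      by (auto simp: Chains_def relation_of_def)
    show "\<exists>u\<in>?A. \<forall>c\<in>C. u \<le> c"
    proof (cases "C = {}")
      case True
      then show ?thesis using p by auto
    next
      case False
      then obtain c where c: "c \<in> C" by blast
      have "x \<le> Inf C \<or> y \<le> Inf C" if xy: "x * y \<le> Inf C" for x y
      proof (rule ccontr)
        assume "\<not> (x \<le> Inf C \<or> y \<le> Inf C)"
        then obtain r s where rs: "r \<in> C" "\<not> x \<le> r" "s \<in> C" "\<not> y \<le> s"
          by (meson le_Inf_iff)
        then obtain t where t: "t \<in> C" "\<not> x \<le> t" "\<not> y \<le> t"
          using C(2)[of r s] order.trans by blast
        moreover have "x * y \<le> t" using xy t(1) by (meson Inf_lower order.trans)
        ultimately show False using C(1) prime_element_multD by blast
      qed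
      moreover have "Inf C \<le> c" using c by (rule Inf_lower)
      moreover have "a \<le> Inf C" using C(1) by (auto intro: Inf_greatest)
      ultimately have "Inf C \<in> ?A"
        using C(1) c not_one_le_prime[of c] by (auto simp: prime_element_def)
      then show ?thesis by (auto intro: Inf_lower)
    qed
  qed
  then obtain m where "m \<in> ?A" "\<And>x. x \<in> ?A \<Longrightarrow> x \<le> m \<Longrightarrow> x = m" by blast
  then have "m \<in> minimal_primes a" "m \<le> p"
    unfolding minimal_primes_def by (auto intro: order.trans)
  then show thesis by (rule that)
qed

lemma minimal_primes_empty_iff:
  fixes a :: "'a::compact_mult_lattice"
  shows "minimal_primes a = {} \<longleftrightarrow> a = 1"
proof
  assume e: "minimal_primes a = {}"
  show "a = 1"
  proof (rule ccontr)
    assume "a \<noteq> 1"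
    then obtain p where "prime_element p" "a \<le> p" by (rule exists_prime_above)
    then show False using e by (metis empty_iff minimal_prime_below)
  qed
qed (auto simp: minimal_primes_def not_one_le_prime)

lemma minimal_primes_eqI:
  fixes a :: "'a::multiplicative_lattice"
  assumes prime: "\<And>p. p \<in> M \<Longrightarrow> prime_element p \<and> a \<le> p"
    and dom: "\<And>q. prime_element q \<Longrightarrow> a \<le> q \<Longrightarrow> \<exists>p\<in>M. p \<le> q"
    and incomparable: "\<And>p q. p \<in> M \<Longrightarrow> q \<in> M \<Longrightarrow> p \<le> q \<Longrightarrow> p = q"
  shows "minimal_primes a = M"
proof
  show "minimal_primes a \<subseteq> M"
  proof
    fix q assume q: "q \<in> minimal_primes a"
    then obtain p where "p \<in> M" "p \<le> q" using dom minimal_primesD by blast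
    then show "q \<in> M" using minimal_primesD(3)[OF q] prime by blast
  qed
  show "M \<subseteq> minimal_primes a"
  proof
    fix p assume p: "p \<in> M"
    have "q = p" if q: "prime_element q" "a \<le> q" "q \<le> p" for q
    proof -
      obtain r where "r \<in> M" "r \<le> q" using dom[OF q(1,2)] by blast
      then show ?thesis using incomparable[of r p] p q by (metis antisym order.trans)
    qed
    then show "p \<in> minimal_primes a" using prime[OF p] by (auto simp: minimal_primes_def)
  qed
qed

lemma comaximal_primes_incomparable:
  assumes "pairwise comaximal M" "\<And>p. p \<in> M \<Longrightarrow> prime_element p" "p \<in> M" "q \<in> M" "p \<le> q"
  shows "p = q"
  using assms comaximal_no_common_prime[of p q q] by (auto simp: pairwise_def)

lemma le_radical: "a \<le> radical a"
  unfolding radical_def by (rule Sup_upper) (auto intro: exI[of _ 1])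

lemma radical_le_prime:
  assumes "prime_element p" "a \<le> p"
  shows "radical a \<le> p"
  unfolding radical_def
  using assms by (auto intro!: Sup_least elim: prime_element_powerD order.trans)

lemma compact_power:
  fixes c :: "'a::compact_mult_lattice"
  assumes "compact_element c"
  shows "compact_element (c ^ n)"
  by (induction n) (auto simp: compact_one intro: compact_mult assms)

lemma compact_Sup_finite:
  fixes F :: "'a::complete_lattice set"
  assumes "finite F" "\<And>c. c \<in> F \<Longrightarrow> compact_element c"
  shows "compact_element (Sup F)"
  unfolding compact_element_def
proof (intro allI impI)
  fix H assume H: "Sup F \<le> Sup H"
  have "\<exists>G. finite G \<and> G \<subseteq> H \<and> c \<le> Sup G" if "c \<in> F" for c
    using assms(2)[OF that] H that unfolding compact_element_def
    by (meson Sup_upper order.trans)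
  then obtain G where G: "\<And>c. c \<in> F \<Longrightarrow> finite (G c) \<and> G c \<subseteq> H \<and> c \<le> Sup (G c)"
    by metis
  have "Sup F \<le> Sup (\<Union>(G ` F))"
  proof (rule Sup_least)
    fix c assume c: "c \<in> F"
    then have "Sup (G c) \<le> Sup (\<Union>(G ` F))" by (intro Sup_subset_mono) auto
    then show "c \<le> Sup (\<Union>(G ` F))" using G[OF c] by (meson order.trans)
  qed
  then show "\<exists>G. finite G \<and> G \<subseteq> H \<and> Sup F \<le> Sup G"
    using G assms(1) by (intro exI[of _ "\<Union>(G ` F)"]) auto
qed

text \<open>
  Otherwise consider an element that is maximal among those over \<open>a\<close> that lie above no power
  of \<open>c\<close>. It exists because the powers of \<open>c\<close> are compact, and it is prime because a product of two powers
  of \<open>c\<close> is again a power of \<open>c\<close>.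
\<close>

lemma compact_power_le_if_below_primes:
  fixes a c :: "'a::compact_mult_lattice"
  assumes c: "compact_element c"
    and below: "\<And>p. prime_element p \<Longrightarrow> a \<le> p \<Longrightarrow> c \<le> p"
  obtains n where "c ^ n \<le> a"
proof (rule ccontr)
  assume "\<not> thesis"
  then have none: "\<not> c ^ n \<le> a" for n using that by blast
  let ?A = "{x. a \<le> x \<and> (\<forall>n. \<not> c ^ n \<le> x)}"
  have "\<exists>m\<in>?A. \<forall>x\<in>?A. m \<le> x \<longrightarrow> x = m"
  proof (rule predicate_Zorn)
    show "partial_order_on ?A (relation_of (\<le>) ?A)"
      by (rule partial_order_on_relation_ofI) auto
  next
    fix C
    assume "C \<in> Chains (relation_of (\<le>) ?A)"
    then have C: "C \<subseteq> ?A" "\<And>x y. x \<in> C \<Longrightarrow> y \<in> C \<Longrightarrow> x \<le> y \<or> y \<le> x"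
      by (auto simp: Chains_def relation_of_def)
    show "\<exists>u\<in>?A. \<forall>x\<in>C. x \<le> u"
    proof (cases "C = {}")
      case True
      then show ?thesis using none by auto
    next
      case False
      have fin: "\<exists>x\<in>C. Sup F \<le> x" if "finite F" "F \<subseteq> C" for F
        using that
      proof (induction F rule: finite_induct)
        case empty
        then show ?case using False by auto
      next
        case (insert y F)
        then obtain x where "x \<in> C" "Sup F \<le> x" by auto
        moreover have "y \<in> C" using insert by auto
        ultimately show ?case using C(2) by (metis Sup_insert le_sup_iff order.trans order_refl)
      qed
      have "\<not> c ^ n \<le> Sup C" for n
      proof
        assume "c ^ n \<le> Sup C"
        then obtain F where F: "finite F" "F \<subseteq> C" "c ^ n \<le> Sup F"
          using compact_power[OF c, of n] unfolding compact_element_def by blast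
        then obtain x where "x \<in> C" "c ^ n \<le> x" using fin by (meson order.trans)
        then show False using C(1) by auto
      qed
      moreover have "a \<le> Sup C" using False C(1) by (auto intro: Sup_upper2)
      ultimately show ?thesis by (auto intro: Sup_upper)
    qed
  qed
  then obtain m where m: "m \<in> ?A" "\<And>x. x \<in> ?A \<Longrightarrow> m \<le> x \<Longrightarrow> x = m" by blast
  have power_above: "\<exists>n. c ^ n \<le> sup m x" if "\<not> x \<le> m" for x
  proof (rule ccontr)
    assume "\<nexists>n. c ^ n \<le> sup m x"
    then have "sup m x = m" using m by (auto intro: le_supI1)
    then show False using that by (simp add: sup.absorb_iff1)
  qed
  have "x \<le> m \<or> y \<le> m" if xy: "x * y \<le> m" for x y
  proof (rule ccontr)
    assume "\<not> (x \<le> m \<or> y \<le> m)"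
    then obtain i j where "c ^ i \<le> sup m x" "c ^ j \<le> sup m y" using power_above by blast
    then have "c ^ (i + j) \<le> sup m x * sup m y"
      unfolding power_add by (rule mult_mono_lattice)
    also have "\<dots> \<le> m"
      using xy mult_le_left[of m] mult_le_right[of _ m]
      by (simp add: mult_sup_distrib mult.commute[of "sup m x"])
         (simp add: mult.commute)
    finally show False using m(1) by blast
  qed
  moreover have "m \<noteq> 1" using m(1) by (auto simp: le_one)
  ultimately have "prime_element m" by (auto simp: prime_element_def)
  then have "c ^ 1 \<le> m" using below m(1) by simp
  then show False using m(1) by blast
qed

text \<open>
  Hence the radical of \<open>a\<close> is the meet of the primes over \<open>a\<close>. The element \<open>x\<close> is a
  join of compact elements, each of which has a power below \<open>a\<close>.
\<close>

lemma le_radical_if_below_primes: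
  fixes a x :: "'a::compact_mult_lattice"
  assumes "\<And>p. prime_element p \<Longrightarrow> a \<le> p \<Longrightarrow> x \<le> p"
  shows "x \<le> radical a"
proof -
  obtain S where S: "S \<subseteq> {c. compact_element c}" "x = Sup S"
    using generates_compact unfolding generates_def by metis
  have "c \<le> radical a" if c: "c \<in> S" for c
  proof -
    have "c \<le> x" using S(2) c by (simp add: Sup_upper)
    then have "c \<le> p" if "prime_element p" "a \<le> p" for p
      using assms[OF that] by (rule order.trans)
    moreover have "compact_element c" using S(1) c by blast
    ultimately obtain n where n: "c ^ n \<le> a"
      using compact_power_le_if_below_primes by blast
    \<comment> \<open>The definition of the radical asks for a positive exponent.\<close>
    have "c ^ Suc n \<le> a" using order.trans[OF mult_le_right[of c "c ^ n"] n] by simp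
    then show ?thesis unfolding radical_def by (intro Sup_upper) (auto intro!: exI[of _ "Suc n"])
  qed
  then show ?thesis using S(2) by (auto intro: Sup_least)
qed

section \<open>CPR-factorizations and minimal primes\<close>

lemma CPR_factorization_iff_set:
  "CPR_factorization a xs \<longleftrightarrow>
     xs \<noteq> [] \<and> distinct xs \<and> a = \<Prod>(set xs) \<and> pairwise comaximal (set xs) \<and>
     (\<forall>x\<in>set xs. x \<noteq> 1 \<and> prime_element (radical x))"
proof (cases "distinct xs")
  case True
  have "(\<forall>i<length xs. \<forall>j<length xs. i \<noteq> j \<longrightarrow> comaximal (xs ! i) (xs ! j)) \<longleftrightarrow>
      pairwise comaximal (set xs)"
    unfolding pairwise_def using True by (metis in_set_conv_nth nth_eq_iff_index_eq)
  moreover have "prod_list xs = \<Prod>(set xs)"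
    using prod.distinct_set_conv_list[OF True, of "\<lambda>x. x"] by simp
  ultimately show ?thesis using True by (auto simp: CPR_factorization_def)
next
  \<comment> \<open>A repeated factor would be comaximal to itself and hence equal to \<open>1\<close>.\<close>
  case False
  then obtain i j where "i < length xs" "j < length xs" "i \<noteq> j" "xs ! i = xs ! j"
    by (auto simp: distinct_conv_nth)
  then have "\<not> CPR_factorization a xs"
    unfolding CPR_factorization_def by (metis comaximal_self_iff nth_mem)
  then show ?thesis using False by blast
qed

lemma radicals_comaximal:
  assumes "comaximal x y"
  shows "comaximal (radical x) (radical y)"
  using comaximal_mono[OF assms le_radical le_radical] .

text \<open>
  A prime over the product lies over some factor and hence over its radical, and the radicals are
  pairwise comaximal, so no two of them are comparable.
\<close>

lemma minimal_primes_of_CPR_factors: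
  fixes S :: "'a::compact_mult_lattice set"
  assumes S: "finite S" "pairwise comaximal S"
    and prime: "\<And>x. x \<in> S \<Longrightarrow> prime_element (radical x)"
  shows "minimal_primes (\<Prod>S) = radical ` S" and "pairwise comaximal (radical ` S)"
proof -
  show comax: "pairwise comaximal (radical ` S)"
    using S(2) radicals_comaximal by (fastforce simp: pairwise_def)
  show "minimal_primes (\<Prod>S) = radical ` S"
  proof (rule minimal_primes_eqI)
    fix p assume "p \<in> radical ` S"
    then show "prime_element p \<and> \<Prod>S \<le> p"
      using prime prod_le_member[OF S(1)] le_radical by (auto intro: order.trans)
  next
    fix q assume "prime_element q" "\<Prod>S \<le> q"
    then show "\<exists>p\<in>radical ` S. p \<le> q"
      using prime_element_prodD[OF S(1)] radical_le_prime by blast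
  next
    fix p q assume "p \<in> radical ` S" "q \<in> radical ` S" "p \<le> q"
    then show "p = q" using comaximal_primes_incomparable[OF comax] prime by blast
  qed
qed

section \<open>Uniqueness\<close>

text \<open>
  The element \<open>x\<close> is comaximal to the cofactor \<open>s\<close> of \<open>y\<close>, so it absorbs \<open>y = y (x \<squnion> s)\<close>.
\<close>

lemma CPR_factor_le:
  fixes S :: "'a::compact_mult_lattice set"
  assumes S: "finite S" "pairwise comaximal S" and y: "y \<in> S"
    and x: "\<Prod>S \<le> x" "radical x = radical y"
  shows "y \<le> x"
proof -
  have "comaximal x z" if z: "z \<in> S - {y}" for z
    unfolding comaximal_iff_no_common_prime
  proof
    assume "\<exists>p. prime_element p \<and> x \<le> p \<and> z \<le> p"
    then obtain p where p: "prime_element p" "x \<le> p" "z \<le> p" by blast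
    have "y \<le> p" using radical_le_prime[OF p(1,2)] x(2) le_radical[of y] by (simp add: order.trans)
    moreover have "comaximal y z" using S(2) y z by (auto simp: pairwise_def)
    ultimately show False using p comaximal_no_common_prime by blast
  qed
  then have "comaximal x (\<Prod>(S - {y}))" using S(1) by (intro comaximal_prod) auto
  then have "y = sup (y * x) (y * \<Prod>(S - {y}))"
    by (simp add: comaximal_def flip: mult_sup_distrib)
  also have "\<dots> = sup (y * x) (\<Prod>S)" using S(1) y by (simp add: prod.remove)
  also have "\<dots> \<le> x" using x(1) by (simp add: mult_le_right)
  finally show ?thesis .
qed

lemma CPR_factors_subset:
  fixes S T :: "'a::compact_mult_lattice set"
  assumes S: "finite S" "pairwise comaximal S" "\<And>x. x \<in> S \<Longrightarrow> prime_element (radical x)"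
    and T: "finite T" "pairwise comaximal T" "\<And>x. x \<in> T \<Longrightarrow> prime_element (radical x)"
    and eq: "\<Prod>S = \<Prod>T"
  shows "S \<subseteq> T"
proof
  fix x assume x: "x \<in> S"
  have "radical ` S = radical ` T"
    using minimal_primes_of_CPR_factors(1)[OF S] minimal_primes_of_CPR_factors(1)[OF T] eq by simp
  then obtain y where y: "y \<in> T" "radical x = radical y" using x by auto
  have "y \<le> x"
    using CPR_factor_le[OF T(1,2) y(1)] y(2) eq prod_le_member[OF S(1) x] by simp
  moreover have "x \<le> y"
    using CPR_factor_le[OF S(1,2) x] y(2) eq prod_le_member[OF T(1) y(1)] by simp
  ultimately show "x \<in> T" using y(1) by simp
qed

lemma CPR_factorization_unique:
  fixes a :: "'a::compact_mult_lattice"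
  assumes "CPR_factorization a xs" "CPR_factorization a ys"
  shows "mset xs = mset ys"
proof -
  have "set xs = set ys"
    by (rule antisym; rule CPR_factors_subset)
       (use assms in \<open>auto simp: CPR_factorization_iff_set\<close>)
  then show ?thesis
    using assms set_eq_iff_mset_eq_distinct unfolding CPR_factorization_iff_set by blast
qed

section \<open>Existence\<close>

text \<open>
  Comaximality is witnessed by compact elements because \<open>1\<close> is compact: finitely many compact
  elements below \<open>u\<close> or \<open>v\<close> already have join \<open>1\<close>.
\<close>

lemma compact_comaximal_below:
  fixes u v :: "'a::compact_mult_lattice"
  assumes "comaximal u v"
  obtains c d where "compact_element c" "compact_element d" "c \<le> u" "d \<le> v" "comaximal c d"
proof -
  obtain C D where CD: "C \<subseteq> {c. compact_element c}" "u = Sup C"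
      "D \<subseteq> {c. compact_element c}" "v = Sup D"
    using generates_compact unfolding generates_def by metis
  then have "1 \<le> Sup (C \<union> D)"
    using assms by (simp add: comaximal_def Sup_union_distrib)
  then obtain F where F: "finite F" "F \<subseteq> C \<union> D" "1 \<le> Sup F"
    using compact_one unfolding compact_element_def by blast
  show thesis
  proof
    show "compact_element (Sup (F \<inter> C))" "compact_element (Sup (F \<inter> D))"
      using F(1) CD by (auto intro!: compact_Sup_finite)
    show "Sup (F \<inter> C) \<le> u" "Sup (F \<inter> D) \<le> v" using CD by (auto intro: Sup_subset_mono)
    have "F = (F \<inter> C) \<union> (F \<inter> D)" using F(2) by blast
    then show "comaximal (Sup (F \<inter> C)) (Sup (F \<inter> D))"
      using F(3) unfolding comaximal_def by (metis Sup_union_distrib one_le_iff)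
  qed
qed

text \<open>
  A decomposition of the set of primes over \<open>a\<close> into those over \<open>u\<close> and those over \<open>v\<close>, with no prime
  in both parts, lifts to a factorization of \<open>a\<close> (the analogue of lifting idempotents modulo
  a nil ideal). The factors are \<open>a \<squnion> c\<^sup>n\<close> and \<open>a \<squnion> d\<^sup>n\<close>, where \<open>c \<le> u\<close> and \<open>d \<le> v\<close>
  are compact and comaximal and \<open>(c d)\<^sup>n \<le> a\<close>.
\<close>

lemma comaximal_splitting:
  fixes a u v :: "'a::compact_mult_lattice"
  assumes uv: "comaximal u v"
    and below: "\<And>p. prime_element p \<Longrightarrow> a \<le> p \<Longrightarrow> u \<le> p \<or> v \<le> p"
  obtains b e where "a = b * e" "comaximal b e"
    "\<And>p. prime_element p \<Longrightarrow> b \<le> p \<longleftrightarrow> a \<le> p \<and> u \<le> p"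
    "\<And>p. prime_element p \<Longrightarrow> e \<le> p \<longleftrightarrow> a \<le> p \<and> v \<le> p"
proof -
  obtain c d where cd: "compact_element c" "compact_element d" "c \<le> u" "d \<le> v" "comaximal c d"
    using uv by (rule compact_comaximal_below)
  have "c * d \<le> p" if p: "prime_element p" "a \<le> p" for p
    using below[OF p] cd(3,4) mult_le_left[of c d] mult_le_right[of c d] by (meson order.trans)
  then obtain n where "(c * d) ^ n \<le> a"
    using compact_power_le_if_below_primes compact_mult cd(1,2) by metis
  then have n: "c ^ n * d ^ n \<le> a" by (simp add: power_mult_distrib)
  define b where "b = sup a (c ^ n)"
  define e where "e = sup a (d ^ n)"
  have be: "comaximal b e"
    unfolding b_def e_def by (rule comaximal_mono[OF comaximal_powers[OF cd(5)]]) (rule sup_ge2)+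
  show thesis
  proof
    show "a = b * e"
    proof (rule antisym)
      have "a = sup (a * b) (a * e)"
        using be by (simp add: comaximal_def flip: mult_sup_distrib)
      also have "\<dots> \<le> b * e"
        by (metis b_def e_def le_sup_iff mult.commute mult_left_monotone sup.cobounded1)
      finally show "a \<le> b * e" .
      have "b * e = sup (b * a) (sup (d ^ n * a) (d ^ n * c ^ n))"
        unfolding e_def by (simp add: mult_sup_distrib b_def mult.commute[of _ "d ^ n"])
      also have "\<dots> \<le> a" using n by (simp add: mult_le_right mult.commute[of "d ^ n" "c ^ n"])
      finally show "b * e \<le> a" .
    qed
    show "comaximal b e" by (rule be)
    fix p :: 'a assume p: "prime_element p"
    have excl: "\<not> (c \<le> p \<and> d \<le> p)" using comaximal_no_common_prime[OF cd(5) p] by blast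
    have powers: "c ^ n \<le> p \<Longrightarrow> c \<le> p" "d ^ n \<le> p \<Longrightarrow> d \<le> p"
      using prime_element_powerD[OF p] by blast+
    \<comment> \<open>The exponent \<open>n\<close> may be \<open>0\<close>, so \<open>c ^ n \<le> p\<close> is derived from primality, not from \<open>c \<le> p\<close>.\<close>
    have split: "c ^ n \<le> p \<or> d ^ n \<le> p" if "a \<le> p"
      using prime_element_multD[OF p] n that by (meson order.trans)
    have below': "u \<le> p \<Longrightarrow> c \<le> p" "v \<le> p \<Longrightarrow> d \<le> p" using cd(3,4) by (auto intro: order.trans)
    show "b \<le> p \<longleftrightarrow> a \<le> p \<and> u \<le> p"
      unfolding b_def le_sup_iff using excl powers split below' below[OF p] by blast
    show "e \<le> p \<longleftrightarrow> a \<le> p \<and> v \<le> p"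
      unfolding e_def le_sup_iff using excl powers split below' below[OF p] by blast
  qed
qed

text \<open>
  The induction also covers \<open>Min(a) = {}\<close>, where \<open>a = 1\<close> is the empty product; each step splits off
  the factor that belongs to one minimal prime.
\<close>

lemma exists_CPR_factors:
  fixes a :: "'a::compact_mult_lattice"
  assumes "finite M" "minimal_primes a = M" "pairwise comaximal M"
  shows "\<exists>S. finite S \<and> a = \<Prod>S \<and> pairwise comaximal S \<and>
           (\<forall>x\<in>S. x \<noteq> 1 \<and> prime_element (radical x))"
  using assms
proof (induction M arbitrary: a rule: finite_induct)
  case empty
  then show ?case by (intro exI[of _ "{}"]) (simp add: minimal_primes_empty_iff)
next
  case (insert p M)
  have min: "q \<in> minimal_primes a \<longleftrightarrow> q = p \<or> q \<in> M" for q using insert.prems(1) by auto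
  have M_prime: "prime_element q" "a \<le> q" if "q = p \<or> q \<in> M" for q
    using minimal_primesD min that by blast+
  have "comaximal p q" if "q \<in> M" for q
    using insert.prems(2) insert.hyps(2) that by (auto simp: pairwise_def)
  then have pv: "comaximal p (\<Prod>M)" by (rule comaximal_prod[OF insert.hyps(1)])
  have "p \<le> q \<or> \<Prod>M \<le> q" if q: "prime_element q" "a \<le> q" for q
    using minimal_prime_below[OF q] min prod_le_member[OF insert.hyps(1)] by (metis order.trans)
  then obtain b e where be: "a = b * e" "comaximal b e"
      and b: "\<And>q. prime_element q \<Longrightarrow> b \<le> q \<longleftrightarrow> a \<le> q \<and> p \<le> q"
      and e: "\<And>q. prime_element q \<Longrightarrow> e \<le> q \<longleftrightarrow> a \<le> q \<and> \<Prod>M \<le> q"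
    using comaximal_splitting[OF pv] by blast
  have p: "prime_element p" "b \<le> p" using M_prime b by blast+
  have "radical b = p"
  proof (rule antisym)
    show "radical b \<le> p" using p by (rule radical_le_prime)
    show "p \<le> radical b" using b by (blast intro: le_radical_if_below_primes)
  qed
  moreover have "b \<noteq> 1" using p not_one_le_prime by blast
  moreover have comax: "pairwise comaximal M"
    using insert.prems(2) by (rule pairwise_subset) blast
  moreover have "minimal_primes e = M"
  proof (rule minimal_primes_eqI)
    show "prime_element q \<and> e \<le> q" if "q \<in> M" for q
      using M_prime e prod_le_member[OF insert.hyps(1)] that by blast
    show "\<exists>r\<in>M. r \<le> q" if "prime_element q" "e \<le> q" for q
      using prime_element_prodD[OF insert.hyps(1)] e that by blast
    show "q = r" if "q \<in> M" "r \<in> M" "q \<le> r" for q r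
      using comaximal_primes_incomparable[OF comax] M_prime that by blast
  qed
  ultimately obtain S where S: "finite S" "e = \<Prod>S" "pairwise comaximal S"
      "\<forall>x\<in>S. x \<noteq> 1 \<and> prime_element (radical x)"
    using insert.IH by blast
  have b_S: "comaximal b x" if "x \<in> S" for x
    using comaximal_mono[OF be(2) order_refl] prod_le_member[OF S(1) that] S(2) by simp
  then have "b \<notin> S" using \<open>b \<noteq> 1\<close> comaximal_self_iff by blast
  then have "a = \<Prod>(insert b S)" using S be(1) by simp
  moreover have "pairwise comaximal (insert b S)"
    using S(3) b_S comaximal_commute by (auto simp: pairwise_insert)
  ultimately show ?case
    using S p(1) \<open>radical b = p\<close> \<open>b \<noteq> 1\<close> by (intro exI[of _ "insert b S"]) auto
qed

lemma CPR_factorization_iff_minimal_primes: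
  fixes a :: "'a::compact_mult_lattice"
  assumes "a \<noteq> 1"
  shows "(\<exists>xs. CPR_factorization a xs) \<longleftrightarrow>
           finite (minimal_primes a) \<and> pairwise comaximal (minimal_primes a)"
proof
  assume "\<exists>xs. CPR_factorization a xs"
  then obtain xs where "a = \<Prod>(set xs)" "pairwise comaximal (set xs)"
      "\<And>x. x \<in> set xs \<Longrightarrow> prime_element (radical x)"
    unfolding CPR_factorization_iff_set by blast
  then show "finite (minimal_primes a) \<and> pairwise comaximal (minimal_primes a)"
    using minimal_primes_of_CPR_factors[of "set xs"] by simp
next
  assume "finite (minimal_primes a) \<and> pairwise comaximal (minimal_primes a)"
  then obtain S where S: "finite S" "a = \<Prod>S" "pairwise comaximal S"
      "\<forall>x\<in>S. x \<noteq> 1 \<and> prime_element (radical x)"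
    using exists_CPR_factors by blast
  obtain xs where "set xs = S" "distinct xs" using finite_distinct_list[OF S(1)] by blast
  moreover from this have "xs \<noteq> []" using S(2) assms by auto
  ultimately show "\<exists>xs. CPR_factorization a xs"
    using S by (auto simp: CPR_factorization_iff_set)
qed

section \<open>CPR-lattices\<close>

lemma minimal_primes_mult_incomparable:
  fixes p q :: "'a::multiplicative_lattice"
  assumes "prime_element p" "prime_element q" "\<not> p \<le> q" "\<not> q \<le> p"
  shows "minimal_primes (p * q) = {p, q}"
  using assms by (intro minimal_primes_eqI)
    (auto simp: mult_le_left mult_le_right dest: prime_element_multD)

lemma CPR_lattice_iff:
  "CPR_lattice TYPE('a::compact_mult_lattice) \<longleftrightarrow>
     treed TYPE('a) \<and> (\<forall>a::'a. a \<noteq> 1 \<longrightarrow> finite (minimal_primes a))"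
proof
  assume "CPR_lattice TYPE('a)"
  then have fin: "finite (minimal_primes a)" and comax: "pairwise comaximal (minimal_primes a)"
    if "a \<noteq> 1" for a :: 'a
    using that CPR_factorization_iff_minimal_primes by (auto simp: CPR_lattice_def)
  have "comaximal p q"
    if pq: "prime_element p" "prime_element q" "\<not> p \<le> q" "\<not> q \<le> p" for p q :: 'a
  proof -
    have "p * q \<noteq> 1" using not_one_le_prime[OF pq(1)] mult_le_left[of p q] by metis
    then have "pairwise comaximal {p, q}"
      using comax minimal_primes_mult_incomparable[OF pq] by metis
    then show ?thesis using pq(3) by (auto simp: pairwise_def)
  qed
  then show "treed TYPE('a) \<and> (\<forall>a::'a. a \<noteq> 1 \<longrightarrow> finite (minimal_primes a))"
    using fin unfolding treed_iff_comaximal by blast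
next
  assume t: "treed TYPE('a) \<and> (\<forall>a::'a. a \<noteq> 1 \<longrightarrow> finite (minimal_primes a))"
  have "comaximal p q" if "p \<in> minimal_primes a" "q \<in> minimal_primes a" "p \<noteq> q" for a p q :: 'a
    using t that minimal_primesD[of p a] minimal_primesD[of q a]
    unfolding treed_iff_comaximal by metis
  then have "pairwise comaximal (minimal_primes a)" for a :: 'a by (auto simp: pairwise_def)
  then show "CPR_lattice TYPE('a)"
    using t CPR_factorization_iff_minimal_primes unfolding CPR_lattice_def by blast
qed

theorem theorem10:
  shows "(\<forall>a::'a::compact_mult_lattice. a \<noteq> 1 \<longrightarrow>
            ((\<exists>xs. CPR_factorization a xs) \<longleftrightarrow>
               finite (minimal_primes a) \<and> pairwise comaximal (minimal_primes a)) \<and>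
            (\<forall>xs ys. CPR_factorization a xs \<and> CPR_factorization a ys \<longrightarrow> mset xs = mset ys))
         \<and>
         (CPR_lattice TYPE('a) \<longleftrightarrow>
            treed TYPE('a) \<and> (\<forall>a::'a. a \<noteq> 1 \<longrightarrow> finite (minimal_primes a)))"
proof (intro conjI allI impI)
  fix a :: 'a assume "a \<noteq> 1"
  then show "(\<exists>xs. CPR_factorization a xs) \<longleftrightarrow>
      finite (minimal_primes a) \<and> pairwise comaximal (minimal_primes a)"
    by (rule CPR_factorization_iff_minimal_primes)
next
  fix a :: 'a and xs ys assume "CPR_factorization a xs \<and> CPR_factorization a ys"
  then show "mset xs = mset ys" by (blast intro: CPR_factorization_unique)
qed (rule CPR_lattice_iff)

end
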